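(* Let $G$ be a group with a finite monoid generating set $A$ (closed under a formal inverse involution $a\mapsto a^{-1}$ with $\overline{a^{-1}}=\overline{a}^{-1}$). Suppose that $G$ possesses, with respect to $A$, a combing $L\subseteq A^*$ which is short, is an asynchronous combing, has a departure function, and is context sensitive (i.e. $L\setminus\{e\}$ is a context sensitive language). Let $H$ be a finitely generated subgroup of $G$. Then $H$ has context sensitive word problem: for any finite monoid generating set $B$ of $H$, the set $\{w\in B^*:\overline{w}=1\}\setminus\{e\}$ is a context sensitive language.
   Context: Notation: $A^*$ is the free monoid on $A$; $\ell(w)$ is the length of $w\in A^*$; $e$ is the empty word; $w\mapsto\overline{w}$ is the monoid homomorphism $A^*\to G$ sending each letter to its value in $G$. The word problem of a group with respect to a finite monoid generating set $B$ is $\{w\in B^*:\overline{w}=1\}$; it is called context sensitive if, after deleting the empty word, it is a context sensitive language. The Cayley graph $\Gamma$ of $G$ w.r.t. $A$ has vertex set $G$ and an edge labelled $a$ from $g$ to $g\overline{a}$; edges are isometric to unit intervals, inducing the word metric $d$ on $G$ and $\ell(g)=d(1,g)$. A word $w$ determines a path $w:[0,\infty)\to\Gamma$ starting at $1$: $w(t)$ for integer $t\le \ell(w)$ is the image of the prefix of length $t$, interpolated along edges, and $w(t)=\overline{w}$ for $t\ge\ell(w)$. A language $L\subseteq A^*$ is a normal form if $\overline{L}=G$. A normal form $L$ is an asynchronous combing if there is a constant $K$ such that for any $w,w'\in L$ with $d(\overline{w},\overline{w'})\le 1$ there are monotone reparametrizations $t\mapsto t'$, $t\mapsto t''$ of $[0,\infty)$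 with $d(w(t'),w'(t''))\le K$ for all $t$. A function $D:\mathbb N\to\mathbb N$ is a departure function for $L$ if for any $w=xyz\in L$ (with $x,y,z\in A^*$) and any $n$, $\ell(y)\ge D(n)$ implies $\ell(\overline{y})\ge n$. $L$ is short if there are constants $\lambda,\epsilon$ with $\ell(w)\le\lambda\,\ell(\overline{w})+\epsilon$ for all $w\in L$. *)

theory Defs
  imports "HOL-Algebra.Group" "HOL-Algebra.Generated_Groups" Complex_Main
begin

definition word_eval :: "('g, 'm) monoid_scheme \<Rightarrow> ('a \<Rightarrow> 'g) \<Rightarrow> 'a list \<Rightarrow> 'g" where
  "word_eval G \<alpha> w = foldr (\<lambda>a x. \<alpha> a \<otimes>\<^bsub>G\<^esub> x) w \<one>\<^bsub>G\<^esub>"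

definition monoid_gen_set :: "('g, 'm) monoid_scheme \<Rightarrow> 'g set \<Rightarrow> 'a set \<Rightarrow> ('a \<Rightarrow> 'g) \<Rightarrow> bool" where
  "monoid_gen_set G H A \<alpha> \<longleftrightarrow> finite A \<and> \<alpha> ` A \<subseteq> H \<and> H = word_eval G \<alpha> ` lists A"

definition inverse_involution :: "('g, 'm) monoid_scheme \<Rightarrow> 'a set \<Rightarrow> ('a \<Rightarrow> 'g) \<Rightarrow> ('a \<Rightarrow> 'a) \<Rightarrow> bool" where
  "inverse_involution G A \<alpha> \<iota> \<longleftrightarrow>
     (\<forall>a\<in>A. \<iota> a \<in> A \<and> \<iota> (\<iota> a) = a \<and> \<alpha> (\<iota> a) = inv\<^bsub>G\<^esub> (\<alpha> a))"

definition cdist :: "('g, 'm) monoid_scheme \<Rightarrow> 'a set \<Rightarrow> ('a \<Rightarrow> 'g) \<Rightarrow> 'g \<Rightarrow> 'g \<Rightarrow> nat" where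
  "cdist G A \<alpha> g h = (LEAST n. \<exists>w\<in>lists A. length w = n \<and> word_eval G \<alpha> w = inv\<^bsub>G\<^esub> g \<otimes>\<^bsub>G\<^esub> h)"

definition wlen :: "('g, 'm) monoid_scheme \<Rightarrow> 'a set \<Rightarrow> ('a \<Rightarrow> 'g) \<Rightarrow> 'g \<Rightarrow> nat" where
  "wlen G A \<alpha> g = cdist G A \<alpha> \<one>\<^bsub>G\<^esub> g"

text \<open>Points of the Cayley graph: a vertex, or an interior point of the edge
  labelled a starting at g, at distance s (0 < s < 1) from g.\<close>
datatype ('g, 'a) cpoint = Vert 'g | EdgePt 'g 'a real

text \<open>The geodesic (path) metric of the Cayley graph, edges isometric to unit intervals.\<close>
fun cpdist :: "('g, 'm) monoid_scheme \<Rightarrow> 'a set \<Rightarrow> ('a \<Rightarrow> 'g) \<Rightarrow> ('g, 'a) cpoint \<Rightarrow> ('g, 'a) cpoint \<Rightarrow> real" where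
  "cpdist G A \<alpha> (Vert g) (Vert h) = real (cdist G A \<alpha> g h)"
| "cpdist G A \<alpha> (Vert g) (EdgePt h b r) =
     min (r + real (cdist G A \<alpha> g h)) ((1 - r) + real (cdist G A \<alpha> g (h \<otimes>\<^bsub>G\<^esub> \<alpha> b)))"
| "cpdist G A \<alpha> (EdgePt g a s) (Vert h) =
     min (s + real (cdist G A \<alpha> g h)) ((1 - s) + real (cdist G A \<alpha> (g \<otimes>\<^bsub>G\<^esub> \<alpha> a) h))"
| "cpdist G A \<alpha> (EdgePt g a s) (EdgePt h b r) =
     (let viaEnds = Min {s + real (cdist G A \<alpha> g h) + r,
                          s + real (cdist G A \<alpha> g (h \<otimes>\<^bsub>G\<^esub> \<alpha> b)) + (1 - r),
                          (1 - s) + real (cdist G A \<alpha> (g \<otimes>\<^bsub>G\<^esub> \<alpha> a) h) + r,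
                          (1 - s) + real (cdist G A \<alpha> (g \<otimes>\<^bsub>G\<^esub> \<alpha> a) (h \<otimes>\<^bsub>G\<^esub> \<alpha> b)) + (1 - r)}
      in if g = h \<and> a = b then min \<bar>s - r\<bar> viaEnds else viaEnds)"

definition word_path :: "('g, 'm) monoid_scheme \<Rightarrow> ('a \<Rightarrow> 'g) \<Rightarrow> 'a list \<Rightarrow> real \<Rightarrow> ('g, 'a) cpoint" where
  "word_path G \<alpha> w t =
     (if real (length w) \<le> t then Vert (word_eval G \<alpha> w)
      else (let k = nat \<lfloor>t\<rfloor>; s = t - real k in
            if s = 0 then Vert (word_eval G \<alpha> (take k w))
            else EdgePt (word_eval G \<alpha> (take k w)) (w ! k) s))"

definition reparam :: "(real \<Rightarrow> real) \<Rightarrow> bool" where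
  "reparam r \<longleftrightarrow> mono_on {0..} r \<and> r ` {0..} = {0..}"

definition normal_form :: "('g, 'm) monoid_scheme \<Rightarrow> 'a set \<Rightarrow> ('a \<Rightarrow> 'g) \<Rightarrow> 'a list set \<Rightarrow> bool" where
  "normal_form G A \<alpha> L \<longleftrightarrow> L \<subseteq> lists A \<and> word_eval G \<alpha> ` L = carrier G"

definition async_combing :: "('g, 'm) monoid_scheme \<Rightarrow> 'a set \<Rightarrow> ('a \<Rightarrow> 'g) \<Rightarrow> 'a list set \<Rightarrow> bool" where
  "async_combing G A \<alpha> L \<longleftrightarrow> normal_form G A \<alpha> L \<and>
     (\<exists>K::real. \<forall>w\<in>L. \<forall>w'\<in>L.
        cdist G A \<alpha> (word_eval G \<alpha> w) (word_eval G \<alpha> w') \<le> 1 \<longrightarrow>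
        (\<exists>r r'. reparam r \<and> reparam r' \<and>
           (\<forall>t\<ge>0. cpdist G A \<alpha> (word_path G \<alpha> w (r t)) (word_path G \<alpha> w' (r' t)) \<le> K)))"

definition departure_function :: "('g, 'm) monoid_scheme \<Rightarrow> 'a set \<Rightarrow> ('a \<Rightarrow> 'g) \<Rightarrow> 'a list set \<Rightarrow> (nat \<Rightarrow> nat) \<Rightarrow> bool" where
  "departure_function G A \<alpha> L D \<longleftrightarrow>
     (\<forall>x y z n. x @ y @ z \<in> L \<longrightarrow> D n \<le> length y \<longrightarrow> n \<le> wlen G A \<alpha> (word_eval G \<alpha> y))"

definition short_lang :: "('g, 'm) monoid_scheme \<Rightarrow> 'a set \<Rightarrow> ('a \<Rightarrow> 'g) \<Rightarrow> 'a list set \<Rightarrow> bool" where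
  "short_lang G A \<alpha> L \<longleftrightarrow>
     (\<exists>c e :: real. \<forall>w\<in>L. real (length w) \<le> c * real (wlen G A \<alpha> (word_eval G \<alpha> w)) + e)"

text \<open>Context sensitive grammar: terminals 'a (Inl), nonterminals nat (Inr),
  finitely many productions of the form \<alpha> X \<beta> \<rightarrow> \<alpha> \<gamma> \<beta> with \<gamma> nonempty.\<close>
definition csg_prods :: "(('a + nat) list \<times> ('a + nat) list) set \<Rightarrow> bool" where
  "csg_prods P \<longleftrightarrow> finite P \<and>
     (\<forall>(l, r)\<in>P. \<exists>u X v g. l = u @ [Inr X] @ v \<and> r = u @ g @ v \<and> g \<noteq> [])"

definition derive_step :: "(('a + nat) list \<times> ('a + nat) list) set \<Rightarrow> ('a + nat) list \<Rightarrow> ('a + nat) list \<Rightarrow> bool" where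
  "derive_step P x y \<longleftrightarrow> (\<exists>u v l r. (l, r) \<in> P \<and> x = u @ l @ v \<and> y = u @ r @ v)"

definition context_sensitive :: "'a list set \<Rightarrow> bool" where
  "context_sensitive L \<longleftrightarrow>
     (\<exists>P S. csg_prods P \<and> L = {w. (derive_step P)\<^sup>*\<^sup>* [Inr S] (map Inl w)})"

definition word_problem :: "('g, 'm) monoid_scheme \<Rightarrow> 'b set \<Rightarrow> ('b \<Rightarrow> 'g) \<Rightarrow> 'b list set" where
  "word_problem G B \<beta> = {w \<in> lists B. word_eval G \<beta> w = \<one>\<^bsub>G\<^esub>}"

end

theory Submission
  imports Defs "HOL-Library.Countable"
begin

text \<open>
  Let F be a large finite ball of G. A list of n elements of F may be changed by local moves, which
  replace adjacent entries g, h by g', h' in F with gh = g'h'. Local moves preserve the product, and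
  rewriting adjacent pairs over a finite alphabet is what a context sensitive grammar can do. So it
  suffices that every list of n generators of H with product 1 can be moved to the list of n
  identity elements.

  To see this, move a list with product g to a combing word for g cut into n chunks of bounded
  length; shortness makes n chunks sufficient. When a letter a is appended to a chunked combing word
  u for g, let u' be a combing word for ga. Pulling a leftwards through the chunks of u, with the
  differences between fellow travelling positions as carried values, produces u' cut into n pieces
  which are bounded as group elements, hence bounded as words by the departure function. Finally any
  two ways of cutting a word into n bounded chunks are related by local moves.
\<close>

section \<open>Pair rewriting by context sensitive grammars\<close>

lemma derive_step_context:
  "derive_step P x y \<Longrightarrow> derive_step P (a @ x @ b) (a @ y @ b)"
  unfolding derive_step_def by (metis append.assoc)

lemma derive_steps_context:
  "(derive_step P)\<^sup>*\<^sup>* x y \<Longrightarrow> (derive_step P)\<^sup>*\<^sup>* (a @ x @ b) (a @ y @ b)"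
  by (induction rule: rtranclp_induct)
    (auto intro: rtranclp.rtrancl_into_rtrancl derive_step_context)

lemma derive_step_prod: "(l, r) \<in> P \<Longrightarrow> derive_step P l r"
  unfolding derive_step_def by (metis append_Nil append_Nil2)

definition pair_step :: "(nat \<times> nat \<times> nat \<times> nat) set \<Rightarrow> nat list \<Rightarrow> nat list \<Rightarrow> bool" where
  "pair_step R x y \<longleftrightarrow>
     (\<exists>u v g h g' h'. (g, h, g', h') \<in> R \<and> x = u @ [g, h] @ v \<and> y = u @ [g', h'] @ v)"

text \<open>A context sensitive production replaces a single symbol, so rewriting a pair takes four
  productions. The two markers carry the whole rule, which binds the second half of a rewriting to
  its first half.\<close>

datatype nonterm = Start | Cell nat | LeftOf "nat \<times> nat \<times> nat \<times> nat" | RightOf "nat \<times> nat \<times> nat \<times> nat"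

instance nonterm :: countable
  by countable_datatype

abbreviation nt :: "nonterm \<Rightarrow> 'b + nat" where
  "nt X \<equiv> Inr (to_nat X)"

definition pair_prods ::
  "(nat \<times> nat \<times> nat \<times> nat) set \<Rightarrow> nat \<Rightarrow> 'b set \<Rightarrow> ('b \<Rightarrow> nat) \<Rightarrow> (('b + nat) list \<times> ('b + nat) list) set"
  where
  "pair_prods R z B \<beta> =
     {([nt Start], [nt Start, nt (Cell z)]), ([nt Start], [nt (Cell z)])}
     \<union> (\<lambda>b. ([nt (Cell (\<beta> b))], [Inl b])) ` B
     \<union> (\<Union>(g, h, g', h')\<in>R. let l = nt (LeftOf (g, h, g', h')); r = nt (RightOf (g, h, g', h')) in
          {([nt (Cell g), nt (Cell h)], [l, nt (Cell h)]),
           ([l, nt (Cell h)], [l, r]),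
           ([l, r], [nt (Cell g'), r]),
           ([nt (Cell g'), r], [nt (Cell g'), nt (Cell h')])})"

lemma csg_pair_prods:
  fixes \<beta> :: "'b \<Rightarrow> nat"
  assumes "finite R" "finite B"
  shows "csg_prods (pair_prods R z B \<beta>)"
proof -
  define cs :: "('b + nat) list \<Rightarrow> ('b + nat) list \<Rightarrow> bool" where
    "cs l r \<longleftrightarrow> (\<exists>u X v g. l = u @ [Inr X] @ v \<and> r = u @ g @ v \<and> g \<noteq> [])" for l r
  have left: "cs [nt p, s] [q, s]" for p :: nonterm and q s :: "'b + nat"
    unfolding cs_def
    by (rule exI[of _ "[]"], rule exI[of _ "to_nat p"], rule exI[of _ "[s]"], rule exI[of _ "[q]"]) simp
  have right: "cs [s, nt p] [s, q]" for p :: nonterm and q s :: "'b + nat"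
    unfolding cs_def
    by (rule exI[of _ "[s]"], rule exI[of _ "to_nat p"], rule exI[of _ "[]"], rule exI[of _ "[q]"]) simp
  have single: "cs [nt p] r" if "r \<noteq> []" for p :: nonterm and r :: "('b + nat) list"
    unfolding cs_def using that
    by (intro exI[of _ "[]"] exI[of _ "to_nat p"] exI[of _ "r"]) simp
  show ?thesis
    unfolding csg_prods_def cs_def[symmetric]
  proof (intro conjI ballI)
    show "finite (pair_prods R z B \<beta>)"
      using assms by (auto simp: pair_prods_def Let_def)
    fix p assume "p \<in> pair_prods R z B \<beta>"
    then show "case p of (l, r) \<Rightarrow> cs l r"
      unfolding pair_prods_def by (auto simp: Let_def intro: left right single)
  qed
qed

text \<open>A cell pair is rewritten at the moment when its right half becomes RightOf:
  LeftOf stands for the old left entry until the matching RightOf follows it.\<close>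

fun decode :: "('b \<Rightarrow> nat) \<Rightarrow> ('b + nat) list \<Rightarrow> nat list" where
  "decode \<beta> [] = []"
| "decode \<beta> (Inl b # xs) = \<beta> b # decode \<beta> xs"
| "decode \<beta> (Inr n # xs) =
     (case from_nat n of
        Start \<Rightarrow> decode \<beta> xs
      | Cell g \<Rightarrow> g # decode \<beta> xs
      | LeftOf (g, h, g', h') \<Rightarrow>
          (if xs \<noteq> [] \<and> hd xs = nt (RightOf (g, h, g', h')) then g' else g) # decode \<beta> xs
      | RightOf (g, h, g', h') \<Rightarrow> h' # decode \<beta> xs)"

lemma decode_map_Inl: "decode \<beta> (map Inl w) = map \<beta> w"
  by (induction w) auto

text \<open>Decoding a symbol looks ahead by one symbol, and only to see which
  \<open>RightOf\<close> stands there, if any. Exchanging a suffix for one whose head agrees in this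
  respect does not disturb the decoded prefix.\<close>

lemma decode_append_cong:
  assumes "x \<noteq> []" "y \<noteq> []"
    and "\<And>p. hd x = nt (RightOf p) \<longleftrightarrow> hd y = nt (RightOf p)"
  shows "\<exists>c. decode \<beta> (u @ x) = c @ decode \<beta> x \<and> decode \<beta> (u @ y) = c @ decode \<beta> y"
proof (induction u)
  case Nil
  show ?case by simp
next
  case (Cons s u)
  then obtain c where c: "decode \<beta> (u @ x) = c @ decode \<beta> x" "decode \<beta> (u @ y) = c @ decode \<beta> y"
    by auto
  have hd: "hd (u @ x) = nt (RightOf p) \<longleftrightarrow> hd (u @ y) = nt (RightOf p)" for p
    using assms by (cases u) auto
  show ?case
  proof (cases s)
    case (Inl b)
    then show ?thesis using c by auto
  next
    case (Inr n)
    then show ?thesis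
      using c hd assms by (auto split: nonterm.split prod.split)
  qed
qed

text \<open>The two \<open>Start\<close> productions insert \<open>z\<close>, and the production
  that creates \<open>RightOf\<close> performs the pair rewriting; all others are invisible to the
  decoding.\<close>

lemma decode_production:
  assumes "(l, r) \<in> pair_prods R z B \<beta>"
  shows "decode \<beta> (r @ v) = decode \<beta> (l @ v) \<or> decode \<beta> (r @ v) = z # decode \<beta> (l @ v) \<or>
    (\<exists>g h g' h' c. (g, h, g', h') \<in> R \<and> decode \<beta> (l @ v) = [g, h] @ c \<and> decode \<beta> (r @ v) = [g', h'] @ c)"
  using assms unfolding pair_prods_def by (auto simp: Let_def)

lemma production_heads:
  assumes "(l, r) \<in> pair_prods R z B \<beta>"
  shows "l \<noteq> []" "r \<noteq> []" "hd l \<noteq> nt (RightOf p)" "hd r \<noteq> nt (RightOf p)"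
  using assms unfolding pair_prods_def by (auto simp: Let_def)

lemma production_terminals:
  assumes "(l, r) \<in> pair_prods R z B \<beta>" "Inl b \<in> set r"
  shows "b \<in> B"
  using assms unfolding pair_prods_def by (auto simp: Let_def)

text \<open>\<open>V\<close> abstracts the strings of product 1. The grammar makes copies of
  \<open>z\<close>, rewrites pairs, and turns entries into terminals. Completeness runs these phases
  in order; soundness cannot assume this order and relies on every decoded string staying in
  \<open>V\<close>.\<close>

theorem context_sensitive_pair_rewriting:
  assumes "finite R" "finite B"
    and nil: "[] \<in> V"
    and insert: "\<And>x y. x @ y \<in> V \<Longrightarrow> x @ z # y \<in> V"
    and step: "\<And>x y. x \<in> V \<Longrightarrow> pair_step R x y \<Longrightarrow> y \<in> V"
    and reach: "\<And>w. w \<in> lists B \<Longrightarrow> w \<noteq> [] \<Longrightarrow> map \<beta> w \<in> V \<Longrightarrow>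
      (pair_step R)\<^sup>*\<^sup>* (replicate (length w) z) (map \<beta> w)"
  shows "context_sensitive ({w \<in> lists B. map \<beta> w \<in> V} - {[]})"
proof -
  let ?P = "pair_prods R z B \<beta>"
  \<comment> \<open>Invariant of all sentential forms. Nonemptiness, preserved because no production
    erases, excludes the empty word.\<close>
  let ?I = "\<lambda>x. x \<noteq> [] \<and> decode \<beta> x \<in> V \<and> (\<forall>b. Inl b \<in> set x \<longrightarrow> b \<in> B)"
  have sound: "?I x" if "(derive_step ?P)\<^sup>*\<^sup>* [nt Start] x" for x
    using that
  proof (induction rule: rtranclp_induct)
    case base
    then show ?case using nil by simp
  next
    case (step x y)
    then obtain u v l r where lr: "(l, r) \<in> ?P" and x: "x = u @ l @ v" and y: "y = u @ r @ v"
      unfolding derive_step_def by blast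
    note heads = production_heads[OF lr]
    obtain c where c: "decode \<beta> x = c @ decode \<beta> (l @ v)" "decode \<beta> y = c @ decode \<beta> (r @ v)"
      using decode_append_cong[of "l @ v" "r @ v" \<beta> u] heads unfolding x y by (auto simp: hd_append)
    have "decode \<beta> y \<in> V"
      using decode_production[OF lr, of v]
    proof (elim disjE exE conjE)
      assume "decode \<beta> (r @ v) = decode \<beta> (l @ v)"
      then show ?thesis using c step.IH by simp
    next
      assume "decode \<beta> (r @ v) = z # decode \<beta> (l @ v)"
      then show ?thesis using c step.IH insert by simp
    next
      fix g h g' h' d
      assume "(g, h, g', h') \<in> R" "decode \<beta> (l @ v) = [g, h] @ d" "decode \<beta> (r @ v) = [g', h'] @ d"
      then have "pair_step R (decode \<beta> x) (decode \<beta> y)"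
        unfolding pair_step_def c by blast
      then show ?thesis using step.IH assms(5) by blast
    qed
    moreover have "\<forall>b. Inl b \<in> set y \<longrightarrow> b \<in> B"
      using step.IH production_terminals[OF lr] unfolding x y by auto
    ultimately show ?case using heads unfolding y by simp
  qed
  have start: "(derive_step ?P)\<^sup>*\<^sup>* [nt Start] (nt Start # replicate n (nt (Cell z)))" for n
  proof (induction n)
    case (Suc n)
    have "derive_step ?P [nt Start] [nt Start, nt (Cell z)]"
      by (rule derive_step_prod) (simp add: pair_prods_def)
    from derive_step_context[OF this, of "[]" "replicate n (nt (Cell z))"] Suc show ?case
      by (simp add: rtranclp.rtrancl_into_rtrancl)
  qed simp
  \<comment> \<open>Changing \<open>Start\<close> itself into a cell makes every positive number of
    cells reachable.\<close>
  have replicate: "(derive_step ?P)\<^sup>*\<^sup>* [nt Start] (replicate (Suc n) (nt (Cell z)))" for n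
  proof -
    have "derive_step ?P [nt Start] [nt (Cell z)]"
      by (rule derive_step_prod) (simp add: pair_prods_def)
    from derive_step_context[OF this, of "[]" "replicate n (nt (Cell z))"] start[of n] show ?thesis
      by (simp add: rtranclp.rtrancl_into_rtrancl)
  qed
  let ?c = "map (\<lambda>g. nt (Cell g))"
  have rewrite_pair: "(derive_step ?P)\<^sup>*\<^sup>* (?c [g, h]) (?c [g', h'])" if R: "(g, h, g', h') \<in> R" for g h g' h'
  proof -
    let ?r = "(g, h, g', h')"
    have 1: "derive_step ?P [nt (Cell g), nt (Cell h)] [nt (LeftOf ?r), nt (Cell h)]"
      and 2: "derive_step ?P [nt (LeftOf ?r), nt (Cell h)] [nt (LeftOf ?r), nt (RightOf ?r)]"
      and 3: "derive_step ?P [nt (LeftOf ?r), nt (RightOf ?r)] [nt (Cell g'), nt (RightOf ?r)]"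
      and 4: "derive_step ?P [nt (Cell g'), nt (RightOf ?r)] [nt (Cell g'), nt (Cell h')]"
      by (rule derive_step_prod, subst pair_prods_def, rule UnI2, rule UN_I[OF R], simp add: Let_def)+
    show ?thesis
      using 1 2 3 4 by (simp add: converse_rtranclp_into_rtranclp)
  qed
  have simulate: "(derive_step ?P)\<^sup>*\<^sup>* (?c x) (?c y)" if "(pair_step R)\<^sup>*\<^sup>* x y" for x y
    using that
  proof (induction rule: rtranclp_induct)
    case (step y y')
    then obtain u v g h g' h' where *: "(g, h, g', h') \<in> R" "y = u @ [g, h] @ v" "y' = u @ [g', h'] @ v"
      unfolding pair_step_def by blast
    have "(derive_step ?P)\<^sup>*\<^sup>* (?c y) (?c y')"
      using derive_steps_context[OF rewrite_pair[OF *(1)], of "?c u" "?c v"] by (simp add: *(2,3))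
    with step.IH show ?case by simp
  qed simp
  have terminate: "(derive_step ?P)\<^sup>*\<^sup>* (?c (map \<beta> w)) (map Inl w)" if "w \<in> lists B" for w
    using that
  proof (induction w)
    case (Cons b w)
    then have "derive_step ?P [nt (Cell (\<beta> b))] [Inl b]"
      by (intro derive_step_prod) (simp add: pair_prods_def)
    from derive_step_context[OF this, of "[]" "?c (map \<beta> w)"]
    have "derive_step ?P (?c (map \<beta> (b # w))) (Inl b # ?c (map \<beta> w))"
      by simp
    also have "(derive_step ?P)\<^sup>*\<^sup>* (Inl b # ?c (map \<beta> w)) (Inl b # map Inl w)"
      using derive_steps_context[of ?P "?c (map \<beta> w)" "map Inl w" "[Inl b]" "[]"] Cons by simp
    finally show ?case by simp
  qed simp
  have "{w \<in> lists B. map \<beta> w \<in> V} - {[]} = {w. (derive_step ?P)\<^sup>*\<^sup>* [Inr (to_nat Start)] (map Inl w)}"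
  proof (intro equalityI subsetI)
    fix w assume w: "w \<in> {w \<in> lists B. map \<beta> w \<in> V} - {[]}"
    then obtain n where n: "length w = Suc n" by (cases w) auto
    have "(derive_step ?P)\<^sup>*\<^sup>* [nt Start] (?c (replicate (length w) z))"
      using replicate[of n] n by (simp add: map_replicate)
    also have "(derive_step ?P)\<^sup>*\<^sup>* (?c (replicate (length w) z)) (?c (map \<beta> w))"
      using w by (intro simulate reach) auto
    also have "(derive_step ?P)\<^sup>*\<^sup>* (?c (map \<beta> w)) (map Inl w)"
      using w by (intro terminate) auto
    finally show "w \<in> {w. (derive_step ?P)\<^sup>*\<^sup>* [Inr (to_nat Start)] (map Inl w)}" by simp
  next
    fix w assume "w \<in> {w. (derive_step ?P)\<^sup>*\<^sup>* [Inr (to_nat Start)] (map Inl w)}"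
    then show "w \<in> {w \<in> lists B. map \<beta> w \<in> V} - {[]}"
      using sound[of "map Inl w"] by (auto simp: decode_map_Inl)
  qed
  then show ?thesis
    unfolding context_sensitive_def using csg_pair_prods[OF assms(1,2)] by blast
qed

section \<open>Local moves and chunked words\<close>

definition local_move :: "('g, 'm) monoid_scheme \<Rightarrow> 'g set \<Rightarrow> 'g list \<Rightarrow> 'g list \<Rightarrow> bool" where
  "local_move G F x y \<longleftrightarrow> (\<exists>u v g h g' h'. {g, h, g', h'} \<subseteq> F \<and> g \<otimes>\<^bsub>G\<^esub> h = g' \<otimes>\<^bsub>G\<^esub> h' \<and>
     x = u @ [g, h] @ v \<and> y = u @ [g', h'] @ v)"

lemma local_move_pair:
  "{g, h, g', h'} \<subseteq> F \<Longrightarrow> g \<otimes>\<^bsub>G\<^esub> h = g' \<otimes>\<^bsub>G\<^esub> h' \<Longrightarrow> local_move G F (u @ g # h # v) (u @ g' # h' # v)"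
  unfolding local_move_def append_Cons append_Nil by blast

lemma local_move_context:
  assumes "local_move G F x y" shows "local_move G F (a @ x @ b) (a @ y @ b)"
proof -
  obtain u v g h g' h' where *: "{g, h, g', h'} \<subseteq> F" "g \<otimes>\<^bsub>G\<^esub> h = g' \<otimes>\<^bsub>G\<^esub> h'"
    "x = u @ [g, h] @ v" "y = u @ [g', h'] @ v"
    using assms unfolding local_move_def by blast
  then show ?thesis
    using local_move_pair[OF *(1,2), of "a @ u" "v @ b"] by simp
qed

lemma local_moves_context:
  "(local_move G F)\<^sup>*\<^sup>* x y \<Longrightarrow> (local_move G F)\<^sup>*\<^sup>* (a @ x @ b) (a @ y @ b)"
  by (induction rule: rtranclp_induct)
    (auto intro: rtranclp.rtrancl_into_rtrancl local_move_context)

lemma local_moves_Cons: "(local_move G F)\<^sup>*\<^sup>* x y \<Longrightarrow> (local_move G F)\<^sup>*\<^sup>* (g # x) (g # y)"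
  using local_moves_context[of G F x y "[g]" "[]"] by simp

lemma local_moves_snoc: "(local_move G F)\<^sup>*\<^sup>* x y \<Longrightarrow> (local_move G F)\<^sup>*\<^sup>* (x @ b) (y @ b)"
  using local_moves_context[of G F x y "[]"] by simp

lemma local_moves_sym: "(local_move G F)\<^sup>*\<^sup>* x y \<Longrightarrow> (local_move G F)\<^sup>*\<^sup>* y x"
proof (rule sympD[OF symp_rtranclp])
  show "symp (local_move G F)"
  proof (rule sympI)
    fix x y assume "local_move G F x y"
    then obtain u v g h g' h' where "{g, h, g', h'} \<subseteq> F" "g \<otimes>\<^bsub>G\<^esub> h = g' \<otimes>\<^bsub>G\<^esub> h'"
      "x = u @ g # h # v" "y = u @ g' # h' # v"
      unfolding local_move_def append_Cons append_Nil by blast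
    then show "local_move G F y x"
      using local_move_pair[of g' h' g h F G u v] by simp
  qed
qed

text \<open>The canonical cut into exactly \<open>n\<close> pieces: full pieces of length
  \<open>M\<close> first, then a remainder, then empty pieces. Letters beyond the first
  \<open>M * n\<close> are lost, so a length bound is needed to recover the word.\<close>

fun greedy_chunks :: "nat \<Rightarrow> nat \<Rightarrow> 'a list \<Rightarrow> 'a list list" where
  "greedy_chunks M 0 u = []"
| "greedy_chunks M (Suc n) u = take M u # greedy_chunks M n (drop M u)"

lemma length_greedy_chunks [simp]: "length (greedy_chunks M n u) = n"
  by (induction n arbitrary: u) auto

lemma greedy_chunks_bound: "c \<in> set (greedy_chunks M n u) \<Longrightarrow> length c \<le> M"
  by (induction n arbitrary: u) auto

lemma concat_greedy_chunks: "length u \<le> M * n \<Longrightarrow> concat (greedy_chunks M n u) = u"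
proof (induction n arbitrary: u)
  case (Suc n)
  then have "concat (greedy_chunks M n (drop M u)) = drop M u" by simp
  then show ?case by simp
qed simp

lemma length_concat_le: "(\<And>c. c \<in> set xs \<Longrightarrow> length c \<le> M) \<Longrightarrow> length (concat xs) \<le> M * length xs"
proof (induction xs)
  case (Cons x xs)
  then have "length x \<le> M" "length (concat xs) \<le> M * length xs" by auto
  then show ?case by simp
qed simp

lemma take_lists: "w \<in> lists A \<Longrightarrow> take i w \<in> lists A"
  by (meson in_lists_conv_set in_set_takeD)

lemma drop_lists: "w \<in> lists A \<Longrightarrow> drop i w \<in> lists A"
  by (meson in_lists_conv_set in_set_dropD)

section \<open>Values of words in a monoid\<close>

lemma word_eval_Nil [simp]: "word_eval G \<alpha> [] = \<one>\<^bsub>G\<^esub>"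
  by (simp add: word_eval_def)

lemma word_eval_Cons [simp]: "word_eval G \<alpha> (a # w) = \<alpha> a \<otimes>\<^bsub>G\<^esub> word_eval G \<alpha> w"
  by (simp add: word_eval_def)

lemma word_eval_map: "word_eval G \<alpha> (map f w) = word_eval G (\<lambda>b. \<alpha> (f b)) w"
  by (induction w) auto

lemma (in monoid) word_eval_closed:
  "(\<And>a. a \<in> set w \<Longrightarrow> \<alpha> a \<in> carrier G) \<Longrightarrow> word_eval G \<alpha> w \<in> carrier G"
  by (induction w) auto

lemma (in monoid) word_eval_append:
  "(\<And>a. a \<in> set u \<union> set v \<Longrightarrow> \<alpha> a \<in> carrier G) \<Longrightarrow>
   word_eval G \<alpha> (u @ v) = word_eval G \<alpha> u \<otimes> word_eval G \<alpha> v"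
  by (induction u) (auto simp: m_assoc word_eval_closed)

lemma (in monoid) word_eval_replicate_one: "word_eval G (\<lambda>g. g) (replicate n \<one>) = \<one>"
  by (induction n) auto

section \<open>Balls and the word metric of a finitely generated group\<close>

locale generated_group = group G for G (structure) +
  fixes A :: "'b set" and \<alpha> :: "'b \<Rightarrow> 'a" and \<iota> :: "'b \<Rightarrow> 'b"
  assumes gen: "monoid_gen_set G (carrier G) A \<alpha>"
    and invol: "inverse_involution G A \<alpha> \<iota>"
begin

abbreviation ev :: "'b list \<Rightarrow> 'a" where "ev \<equiv> word_eval G \<alpha>"

text \<open>The ball of radius \<open>n\<close> about the identity in the Cayley graph. Length
  bounds become membership in a finite set, which can serve as an alphabet.\<close>

definition gball :: "nat \<Rightarrow> 'a set" where
  "gball n = ev ` {w \<in> lists A. length w \<le> n}"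

lemma value_closed: "a \<in> A \<Longrightarrow> \<alpha> a \<in> carrier G"
  using gen unfolding monoid_gen_set_def image_subset_iff by metis

lemma ev_closed [simp, intro]: "w \<in> lists A \<Longrightarrow> ev w \<in> carrier G"
  by (rule word_eval_closed) (auto intro: value_closed)

lemma ev_append: "u \<in> lists A \<Longrightarrow> v \<in> lists A \<Longrightarrow> ev (u @ v) = ev u \<otimes> ev v"
  by (rule word_eval_append) (auto intro: value_closed)

lemma ex_word: "g \<in> carrier G \<Longrightarrow> \<exists>w\<in>lists A. ev w = g"
  using gen unfolding monoid_gen_set_def by (metis imageE)

lemma finite_gball: "finite (gball n)"
proof -
  have "finite {w. set w \<subseteq> A \<and> length w \<le> n}"
    using gen finite_lists_length_le unfolding monoid_gen_set_def by blast
  moreover have "{w \<in> lists A. length w \<le> n} = {w. set w \<subseteq> A \<and> length w \<le> n}"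
    by auto
  ultimately show ?thesis by (simp add: gball_def)
qed

lemma gballI: "w \<in> lists A \<Longrightarrow> length w \<le> n \<Longrightarrow> ev w \<in> gball n"
  unfolding gball_def by blast

lemma gball_mono: "m \<le> n \<Longrightarrow> gball m \<subseteq> gball n"
  unfolding gball_def by (rule image_mono) auto

lemma gball_closed: "g \<in> gball n \<Longrightarrow> g \<in> carrier G"
  unfolding gball_def by (elim imageE) simp

lemma one_gball: "\<one> \<in> gball n"
  using gballI[of "[]" n] by simp

lemma gball_mult:
  assumes "g \<in> gball m" "h \<in> gball n" shows "g \<otimes> h \<in> gball (m + n)"
proof -
  obtain u v where "u \<in> lists A" "v \<in> lists A" "length u \<le> m" "length v \<le> n" "g = ev u" "h = ev v"
    using assms unfolding gball_def by blast
  then show ?thesis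
    using gballI[of "u @ v" "m + n"] by (auto simp: ev_append)
qed

lemma ev_inverse: "w \<in> lists A \<Longrightarrow> ev (rev (map \<iota> w)) = inv (ev w)"
proof (induction w)
  case (Cons a w)
  then have a: "a \<in> A" "\<iota> a \<in> A" "\<alpha> (\<iota> a) = inv (\<alpha> a)" and w: "w \<in> lists A"
    using invol unfolding inverse_involution_def by auto
  have "rev (map \<iota> w) \<in> lists A"
    using w invol unfolding inverse_involution_def by (auto simp: lists_eq_set)
  then show ?case
    using Cons a w by (simp add: ev_append inv_mult_group value_closed)
qed simp

text \<open>Reversing a word and inverting its letters formally keeps the length.\<close>

lemma gball_inv: assumes "g \<in> gball n" shows "inv g \<in> gball n"
proof -
  obtain w where w: "w \<in> lists A" "length w \<le> n" "g = ev w"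
    using assms unfolding gball_def by blast
  have "rev (map \<iota> w) \<in> lists A"
    using w invol unfolding inverse_involution_def by (auto simp: lists_eq_set)
  then show ?thesis
    using w gballI[of "rev (map \<iota> w)" n] by (simp add: ev_inverse)
qed

text \<open>The minimum defining \<open>cdist\<close> is attained because \<open>A\<close> generates
  the group. From here on distances are handled through balls.\<close>

lemma cdist_le_iff:
  assumes "g \<in> carrier G" "h \<in> carrier G"
  shows "cdist G A \<alpha> g h \<le> n \<longleftrightarrow> inv g \<otimes> h \<in> gball n"
proof -
  let ?Q = "\<lambda>n. \<exists>w\<in>lists A. length w = n \<and> ev w = inv g \<otimes> h"
  have "\<exists>n. ?Q n"
    using ex_word[of "inv g \<otimes> h"] assms by auto
  then have "?Q (cdist G A \<alpha> g h)"
    unfolding cdist_def by (rule LeastI_ex)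
  then show ?thesis
  proof (intro iffI)
    assume "cdist G A \<alpha> g h \<le> n"
    with \<open>?Q (cdist G A \<alpha> g h)\<close> show "inv g \<otimes> h \<in> gball n"
      using gballI by metis
  next
    assume "inv g \<otimes> h \<in> gball n"
    then obtain w where "w \<in> lists A" "length w \<le> n" "ev w = inv g \<otimes> h"
      unfolding gball_def by force
    then show "cdist G A \<alpha> g h \<le> n"
      unfolding cdist_def using Least_le[of ?Q "length w"] by force
  qed
qed

lemma wlen_le_iff: "g \<in> carrier G \<Longrightarrow> wlen G A \<alpha> g \<le> n \<longleftrightarrow> g \<in> gball n"
  unfolding wlen_def by (simp add: cdist_le_iff)

text \<open>By symmetry of moves, this connects any two cuts of a word into \<open>n\<close> chunks
  of length at most \<open>M\<close>. Make the tail greedy, fill the first chunk from the second by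
  one move, then make the tail greedy again.\<close>

lemma rechunk_greedy:
  assumes "gball M \<subseteq> F"
  shows "length xs = n \<Longrightarrow> (\<And>c. c \<in> set xs \<Longrightarrow> length c \<le> M) \<Longrightarrow> concat xs \<in> lists A \<Longrightarrow>
    (local_move G F)\<^sup>*\<^sup>* (map ev xs) (map ev (greedy_chunks M n (concat xs)))"
proof (induction n arbitrary: xs)
  case (Suc n)
  obtain x xs' where xs: "xs = x # xs'" "length xs' = n"
    using Suc.prems(1) by (cases xs) auto
  let ?v = "concat xs'" and ?k = "M - length x"
  have x: "length x \<le> M" "x \<in> lists A" and v: "?v \<in> lists A" "length ?v \<le> M * n"
    using Suc.prems xs length_concat_le[of xs' M] by auto
  have tail: "(local_move G F)\<^sup>*\<^sup>* (map ev xs') (map ev (greedy_chunks M n ?v))"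
    using Suc xs by auto
  show ?case
  proof (cases n)
    case 0
    then show ?thesis using xs x by simp
  next
    case (Suc m)
    \<comment> \<open>\<open>c1\<close> is what the first chunk lacks, as far as letters are
      available, and \<open>c2\<close> is the rest of the second chunk. One move suffices: the
      second chunk is already greedy, so it contains all of \<open>c1\<close>.\<close>
    define c1 c2 where "c1 = take ?k ?v" and "c2 = drop ?k (take M ?v)"
    define rest where "rest = greedy_chunks M m (drop M ?v)"
    have rest: "concat rest = drop M ?v" "length rest = m" "\<And>d. d \<in> set rest \<Longrightarrow> length d \<le> M"
      using v(2) Suc unfolding rest_def
      by (auto intro!: concat_greedy_chunks simp: algebra_simps dest: greedy_chunks_bound)
    have c: "c1 \<in> lists A" "c2 \<in> lists A" "length c1 \<le> ?k" "length c2 \<le> M"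
      unfolding c1_def c2_def using v(1) by (simp_all add: take_lists drop_lists)
    have "take ?k (take M ?v) = c1"
      by (simp add: c1_def min_def)
    then have v_take: "take M ?v = c1 @ c2"
      unfolding c2_def by (metis append_take_drop_id)
    have "length (c1 @ c2) \<le> M"
      unfolding v_take[symmetric] by simp
    moreover have "length (x @ c1) \<le> M"
      using x(1) c(3) by simp
    ultimately have "{ev x, ev (c1 @ c2), ev (x @ c1), ev c2} \<subseteq> F"
      using x c by (simp add: subsetD[OF assms] gballI)
    moreover have "ev x \<otimes> ev (c1 @ c2) = ev (x @ c1) \<otimes> ev c2"
      using x c by (simp add: ev_append m_assoc)
    ultimately have move: "local_move G F ([] @ ev x # ev (c1 @ c2) # map ev rest)
        ([] @ ev (x @ c1) # ev c2 # map ev rest)"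
      by (rule local_move_pair)
    have v_drop: "c2 @ drop M ?v = drop ?k ?v"
    proof -
      have "drop ?k ?v = drop ?k (take M ?v @ drop M ?v)" by simp
      also have "\<dots> = c2 @ drop M ?v"
        unfolding c2_def drop_append by (cases "length ?v < M") auto
      finally show ?thesis ..
    qed
    \<comment> \<open>The second chunk may no longer be full after giving up \<open>c1\<close>,
      hence a second use of the induction hypothesis.\<close>
    have "(local_move G F)\<^sup>*\<^sup>* (map ev (c2 # rest)) (map ev (greedy_chunks M n (concat (c2 # rest))))"
    proof (rule Suc.IH)
      show "length (c2 # rest) = n" using \<open>n = Suc m\<close> rest by simp
      show "length d \<le> M" if "d \<in> set (c2 # rest)" for d
        using that rest c by auto
      show "concat (c2 # rest) \<in> lists A"
        using rest(1) v_drop drop_lists[OF v(1)] by simp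
    qed
    then have "(local_move G F)\<^sup>*\<^sup>* (map ev (c2 # rest)) (map ev (greedy_chunks M n (drop ?k ?v)))"
      using rest(1) v_drop by simp
    moreover have "take M (concat xs) = x @ c1" "drop M (concat xs) = drop ?k ?v"
      using xs x by (simp_all add: c1_def)
    ultimately have "(local_move G F)\<^sup>*\<^sup>* (ev (x @ c1) # map ev (c2 # rest))
       (map ev (greedy_chunks M (Suc n) (concat xs)))"
      by (simp only: greedy_chunks.simps list.map local_moves_Cons)
    moreover have "(local_move G F)\<^sup>*\<^sup>* (map ev xs) (ev x # ev (c1 @ c2) # map ev rest)"
      using local_moves_Cons[OF tail, of "ev x"] xs \<open>n = Suc m\<close> by (simp add: rest_def v_take)
    moreover have "local_move G F (ev x # ev (c1 @ c2) # map ev rest) (ev (x @ c1) # map ev (c2 # rest))"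
      using move by simp
    ultimately show ?thesis
      by (meson rtranclp.rtrancl_into_rtrancl rtranclp_trans)
  qed
qed simp

text \<open>A carried value travels from right to left: the pair of \<open>h j\<close> and
  \<open>d (Suc j) \<otimes> c\<close> becomes \<open>d j \<otimes> y j\<close> and
  \<open>c\<close>, and then \<open>y j\<close> takes the role of \<open>c\<close>. At the left end
  the carried difference is \<open>d 0 = \<one>\<close>, so nothing is left over.\<close>

lemma strip_moves:
  assumes "d 0 = \<one>"
    and "\<And>j. j < n \<Longrightarrow> h j \<otimes> d (Suc j) = d j \<otimes> y j"
    and "\<And>j. j < n \<Longrightarrow> {h j, y j, h j \<otimes> d (Suc j)} \<subseteq> F"
    and "\<And>j. j \<le> n \<Longrightarrow> d j \<in> carrier G"
    and "F \<subseteq> carrier G" "c \<in> F" "d n \<otimes> c \<in> F"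
  shows "(local_move G F)\<^sup>*\<^sup>* (map h [0..<n] @ [d n \<otimes> c]) (map y [0..<n] @ [c])"
  using assms
proof (induction n arbitrary: c)
  case 0
  then show ?case by (auto dest: subsetD)
next
  case (Suc n)
  have eq: "h n \<otimes> d (Suc n) = d n \<otimes> y n" using Suc.prems(2) by simp
  have F: "h n \<in> F" "y n \<in> F" "h n \<otimes> d (Suc n) \<in> F" using Suc.prems(3)[of n] by auto
  have "h n \<otimes> (d (Suc n) \<otimes> c) = (h n \<otimes> d (Suc n)) \<otimes> c"
    using F Suc.prems by (metis m_assoc order_refl subsetD)
  then have "local_move G F (map h [0..<n] @ [h n, d (Suc n) \<otimes> c]) (map h [0..<n] @ [d n \<otimes> y n, c])"
    using F Suc.prems eq by (intro local_move_pair) auto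
  moreover have "(local_move G F)\<^sup>*\<^sup>* (map h [0..<n] @ [d n \<otimes> y n]) (map y [0..<n] @ [y n])"
    using F eq Suc.prems by (intro Suc.IH) auto
  from local_moves_snoc[OF this, of "[c]"]
  have "(local_move G F)\<^sup>*\<^sup>* (map h [0..<n] @ [d n \<otimes> y n, c]) (map y [0..<n] @ [y n, c])" by simp
  ultimately show ?case by simp
qed

section \<open>Fellow travelling at integer positions\<close>

lemma cpdist_Vert_word_path:
  assumes "g \<in> carrier G" "w \<in> lists A" "0 \<le> s"
    and "cpdist G A \<alpha> (Vert g) (word_path G \<alpha> w s) \<le> real K"
  shows "inv g \<otimes> ev (take (nat \<lfloor>s\<rfloor>) w) \<in> gball (Suc K)"
proof (cases "real (length w) \<le> s")
  case True
  then have "take (nat \<lfloor>s\<rfloor>) w = w"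
    using \<open>0 \<le> s\<close> by (simp add: le_nat_floor)
  moreover have "cdist G A \<alpha> g (ev w) \<le> K"
    using assms(4) True by (simp add: word_path_def)
  ultimately show ?thesis
    using assms cdist_le_iff[of g "ev w" K] gball_mono[of K "Suc K"] by auto
next
  case False
  define k where "k = nat \<lfloor>s\<rfloor>"
  define h where "h = ev (take k w)"
  have k: "real k \<le> s" "s < real k + 1" "k < length w"
    using False \<open>0 \<le> s\<close> unfolding k_def by linarith+
  have h: "h \<in> carrier G"
    unfolding h_def using assms(2) by (simp add: take_lists)
  have b: "w ! k \<in> A"
    using assms(2) k(3) by (metis in_lists_conv_set nth_mem)
  show ?thesis
  proof (cases "s = real k")
    case True
    then have "cdist G A \<alpha> g h \<le> K"
      using assms(4) False by (simp add: word_path_def h_def)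
    then show ?thesis
      using assms h cdist_le_iff[of g h K] gball_mono[of K "Suc K"] by (auto simp: h_def k_def)
  next
    case s: False
    \<comment> \<open>The point lies inside the edge leaving \<open>h\<close> and is rounded down to
      \<open>h\<close>. A route through \<open>h\<close> only gets shorter; a route through the
      other end is extended by one letter, which is the origin of \<open>Suc K\<close>.\<close>
    define r where "r = s - real k"
    have r: "0 \<le> r" "r \<le> 1" using k by (simp_all add: r_def)
    have "word_path G \<alpha> w s = EdgePt h (w ! k) r"
      using False s by (simp add: word_path_def Let_def k_def h_def r_def)
    then have "r + real (cdist G A \<alpha> g h) \<le> K \<or>
        (1 - r) + real (cdist G A \<alpha> g (h \<otimes> \<alpha> (w ! k))) \<le> K"
      using assms(4) by (auto simp: min_def split: if_splits)
    then have "inv g \<otimes> h \<in> gball (Suc K)"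
    proof
      assume "r + real (cdist G A \<alpha> g h) \<le> K"
      then have "cdist G A \<alpha> g h \<le> K" using r by linarith
      then show ?thesis
        using assms h cdist_le_iff[of g h K] gball_mono[of K "Suc K"] by auto
    next
      let ?b = "\<alpha> (w ! k)"
      have B: "?b \<in> carrier G" "?b \<in> gball 1"
        using value_closed[OF b] gballI[of "[w ! k]" 1] b by simp_all
      assume "(1 - r) + real (cdist G A \<alpha> g (h \<otimes> ?b)) \<le> K"
      then have "cdist G A \<alpha> g (h \<otimes> ?b) \<le> K" using r by linarith
      then have "inv g \<otimes> (h \<otimes> ?b) \<in> gball K"
        using assms h B cdist_le_iff[of g "h \<otimes> ?b" K] by simp
      from gball_mult[OF this gball_inv[OF B(2)]] show ?thesis
        using assms h B by (simp add: m_assoc)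
    qed
    then show ?thesis by (simp add: h_def k_def)
  qed
qed

text \<open>Surjectivity of \<open>r\<close> gives a time at which the first path is at position
  \<open>q\<close>; \<open>p q\<close> is the position of the second path at that time, rounded
  down.\<close>

lemma fellow_positions:
  assumes "reparam r" "reparam r'"
    and "\<forall>t\<ge>0. cpdist G A \<alpha> (word_path G \<alpha> u (r t)) (word_path G \<alpha> u' (r' t)) \<le> real K"
    and u: "u \<in> lists A" and u': "u' \<in> lists A"
  shows "\<exists>p :: nat \<Rightarrow> nat. mono p \<and>
    (\<forall>q\<le>length u. inv (ev (take q u)) \<otimes> ev (take (p q) u') \<in> gball (Suc K))"
proof -
  have "\<exists>t\<ge>0. r t = real q" for q
  proof -
    have "real q \<in> r ` {0..}" using assms(1) by (simp add: reparam_def)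
    then show ?thesis by force
  qed
  then obtain t where t: "\<And>q. 0 \<le> t q" "\<And>q. r (t q) = real q"
    by metis
  have nonneg: "0 \<le> r' s" if "0 \<le> s" for s
    using assms(2) that unfolding reparam_def by (metis atLeast_iff image_eqI)
  \<comment> \<open>\<open>r\<close> is only weakly monotone, but it takes different values at the
    times of different positions, which forces these times into order.\<close>
  have mono_t: "t q \<le> t q'" if "q \<le> q'" for q q'
  proof (rule ccontr)
    assume *: "\<not> t q \<le> t q'"
    then have "r (t q') \<le> r (t q)"
      using assms(1) t(1) unfolding reparam_def by (intro mono_onD[of "{0..}" r]) auto
    then have "q' \<le> q" using t(2) by simp
    with that * show False by simp
  qed
  define p where "p q = nat \<lfloor>r' (t q)\<rfloor>" for q
  have "mono p"
    unfolding p_def mono_def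
  proof (intro allI impI nat_mono floor_mono)
    fix q q' :: nat assume "q \<le> q'"
    then show "r' (t q) \<le> r' (t q')"
      using assms(2) t(1) mono_t unfolding reparam_def by (intro mono_onD[of "{0..}" r']) auto
  qed
  moreover have "inv (ev (take q u)) \<otimes> ev (take (p q) u') \<in> gball (Suc K)" if "q \<le> length u" for q
    unfolding p_def
  proof (rule cpdist_Vert_word_path)
    have "word_path G \<alpha> u (real q) = Vert (ev (take q u))"
      using that by (auto simp: word_path_def)
    then show "cpdist G A \<alpha> (Vert (ev (take q u))) (word_path G \<alpha> u' (r' (t q))) \<le> real K"
      using assms(3) t by metis
  qed (use u u' t nonneg in \<open>simp_all add: take_lists\<close>)
  ultimately show ?thesis by blast
qed

end

section \<open>Moving along an asynchronous combing with a departure function\<close>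

locale combed_group = generated_group +
  fixes L :: "'c list set" and K :: nat and D :: "nat \<Rightarrow> nat"
  assumes nf: "normal_form G A \<alpha> L"
    and fellow: "\<And>w w'. w \<in> L \<Longrightarrow> w' \<in> L \<Longrightarrow> cdist G A \<alpha> (ev w) (ev w') \<le> 1 \<Longrightarrow>
        \<exists>r r'. reparam r \<and> reparam r' \<and>
           (\<forall>t\<ge>0. cpdist G A \<alpha> (word_path G \<alpha> w (r t)) (word_path G \<alpha> w' (r' t)) \<le> real K)"
    and departure: "departure_function G A \<alpha> L D"
begin

lemma L_lists: "u \<in> L \<Longrightarrow> u \<in> lists A"
  using nf unfolding normal_form_def by (metis subsetD)

lemma ex_L: "g \<in> carrier G \<Longrightarrow> \<exists>u\<in>L. ev u = g"
  using nf unfolding normal_form_def by (metis imageE)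

text \<open>Cut \<open>u\<close> into \<open>n\<close> chunks of length at most \<open>M\<close> and
  cut \<open>u'\<close> at fellow travelling positions. A piece of \<open>u'\<close> differs from a
  chunk of \<open>u\<close> by two elements of length at most \<open>Suc K\<close>, so its value has
  length at most \<open>M + 2 * Suc K\<close>; the departure function turns this into the bound
  \<open>M'\<close> on its word length. Thus \<open>u'\<close> fits into \<open>n\<close> chunks
  without a separate bound on its length. The entry \<open>c\<close> is what later steps still have
  to absorb.\<close>

lemma comb_step:
  assumes u: "u \<in> L" and u': "u' \<in> L" and "0 < n"
    and len: "length u \<le> M * n"
    and e: "e \<in> gball 1" "ev u' = ev u \<otimes> e"
    and M': "M \<le> M'" "D (Suc (M + 2 * Suc K)) \<le> M'"
    and F: "gball M' \<subseteq> F" "gball (M + 2 * Suc K) \<subseteq> F" "F \<subseteq> carrier G"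
    and c: "c \<in> F" "e \<otimes> c \<in> F"
  shows "(local_move G F)\<^sup>*\<^sup>* (map ev (greedy_chunks M' n u) @ [e \<otimes> c])
    (map ev (greedy_chunks M' n u') @ [c])"
proof -
  note A = L_lists[OF u] L_lists[OF u']
  have ec: "e \<in> carrier G" using e gball_closed by simp
  have e_eq: "inv (ev u) \<otimes> ev u' = e"
    using A ec e(2) by (simp add: m_assoc[symmetric])
  have "cdist G A \<alpha> (ev u) (ev u') \<le> 1"
    using cdist_le_iff[of "ev u" "ev u'" 1] ev_closed[OF A(1)] ev_closed[OF A(2)] e(1) e_eq by metis
  then obtain p where p: "mono p"
    "\<And>q. q \<le> length u \<Longrightarrow> inv (ev (take q u)) \<otimes> ev (take (p q) u') \<in> gball (Suc K)"
    using fellow[OF u u'] fellow_positions[OF _ _ _ A] by blast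
  define xs where "xs = greedy_chunks M n u"
  have xs: "concat xs = u" "length xs = n" "\<And>x. x \<in> set xs \<Longrightarrow> length x \<le> M"
    unfolding xs_def using len by (auto simp: concat_greedy_chunks dest: greedy_chunks_bound)
  define q where "q j = length (concat (take j xs))" for j
  have u_take: "take (q j) u = concat (take j xs)" for j
  proof -
    have "u = concat (take j xs) @ concat (drop j xs)"
      using xs(1) by (metis append_take_drop_id concat_append)
    then show ?thesis unfolding q_def by (metis append_eq_conv_conj)
  qed
  have q_le: "q j \<le> length u" for j
    by (metis length_take min.cobounded1 min.cobounded2 q_def u_take nle_le min_def)
  have q_Suc: "q (Suc j) = q j + length (xs ! j)" if "j < n" for j
    using that xs(2) unfolding q_def by (simp add: take_Suc_conv_app_nth)
  text \<open>The times chosen for the endpoints of one word need not hit the endpoints of the other,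
    so the extreme positions are set by hand.\<close>
  define b where "b j = (if j = 0 then 0 else if n \<le> j then length u' else min (length u') (p (q j)))" for j
  have b_mono: "b j \<le> b (Suc j)" if "j < n" for j
    using monoD[OF p(1), of "q j" "q (Suc j)"] q_Suc[OF that] \<open>0 < n\<close> unfolding b_def by auto
  have b_le: "b j \<le> length u'" for j unfolding b_def by simp
  \<comment> \<open>The difference between the two words at the \<open>j\<close>-th cut. The choice
    of \<open>b\<close> at the ends gives \<open>d 0 = \<one>\<close> and
    \<open>d n = e\<close>.\<close>
  define d where "d j = inv (ev (take (q j) u)) \<otimes> ev (take (b j) u')" for j
  have d0: "d 0 = \<one>" unfolding d_def q_def b_def by simp
  have qn: "take (q n) u = u" unfolding u_take using xs by simp
  have dn: "d n = e" unfolding d_def qn using e_eq \<open>0 < n\<close> by (simp add: b_def)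
  have d: "d j \<in> gball (Suc K)" if "j \<le> n" for j
  proof -
    consider "j = 0" | "j = n" | "0 < j" "j < n" using \<open>j \<le> n\<close> by linarith
    then show ?thesis
    proof cases
      case 1 then show ?thesis using d0 one_gball by simp
    next
      case 2 then show ?thesis using dn e(1) gball_mono[of 1 "Suc K"] by auto
    next
      case 3
      \<comment> \<open>The truncation in \<open>b\<close> keeps the cuts inside \<open>u'\<close>
        and does not change the prefix.\<close>
      have "take (min (length u') (p (q j))) u' = take (p (q j)) u'" by (simp add: min_def)
      then show ?thesis using p(2)[OF q_le, of j] 3 unfolding d_def b_def by simp
    qed
  qed
  define y where "y j = take (b (Suc j) - b j) (drop (b j) u')" for j
  have y_split: "take (b (Suc j)) u' = take (b j) u' @ y j" if "j < n" for j
    using b_mono[OF that] unfolding y_def by (metis le_add_diff_inverse take_add)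
  have yA: "y j \<in> lists A" for j unfolding y_def using A(2) by (simp add: take_lists drop_lists)
  have xsA: "xs ! j \<in> lists A" "length (xs ! j) \<le> M" if "j < n" for j
    using A(1) xs that by (force simp: lists_eq_set)+
  have q_split: "ev (take (q (Suc j)) u) = ev (take (q j) u) \<otimes> ev (xs ! j)" if "j < n" for j
  proof -
    have "take (q (Suc j)) u = take (q j) u @ xs ! j"
      unfolding u_take using that xs(2) by (simp add: take_Suc_conv_app_nth)
    then show ?thesis using A xsA[OF that] by (simp add: ev_append take_lists)
  qed
  \<comment> \<open>Both sides are the difference between the start of the \<open>j\<close>-th chunk
    in \<open>u\<close> and the end of the \<open>j\<close>-th piece in \<open>u'\<close>.\<close>
  have strip: "ev (xs ! j) \<otimes> d (Suc j) = d j \<otimes> ev (y j)" if "j < n" for j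
  proof -
    have c: "ev (take i u) \<in> carrier G" "ev (take i u') \<in> carrier G" "ev (y j) \<in> carrier G" "ev (xs ! j) \<in> carrier G" for i
      using A yA xsA[OF that] by (simp_all add: take_lists)
    have "ev (xs ! j) \<otimes> d (Suc j) =
      ev (xs ! j) \<otimes> (inv (ev (xs ! j)) \<otimes> inv (ev (take (q j) u)) \<otimes> (ev (take (b j) u') \<otimes> ev (y j)))"
      unfolding d_def q_split[OF that] y_split[OF that] using c A yA by (simp add: inv_mult_group ev_append take_lists)
    also have "\<dots> = d j \<otimes> ev (y j)"
      unfolding d_def using c by (simp add: m_assoc[symmetric])
    finally show ?thesis .
  qed
  have hd_ball: "ev (xs ! j) \<otimes> d (Suc j) \<in> gball (M + Suc K)" if "j < n" for j
    using gball_mult[OF gballI d] xsA[OF that] that by simp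
  \<comment> \<open>The value of \<open>y j\<close> is the fourth side of a quadrilateral with sides
    \<open>d j\<close>, \<open>ev (xs ! j)\<close> and \<open>d (Suc j)\<close>.\<close>
  have y_ball: "ev (y j) \<in> gball (M + 2 * Suc K)" if "j < n" for j
  proof -
    have "d j \<in> carrier G" using d gball_closed that by (meson less_imp_le)
    then have "ev (y j) = inv (d j) \<otimes> (d j \<otimes> ev (y j))"
      using yA by (simp add: m_assoc[symmetric])
    also have "\<dots> \<in> gball (Suc K + (M + Suc K))"
      using gball_mult[OF gball_inv[OF d] hd_ball] strip that by simp
    also have "Suc K + (M + Suc K) = M + 2 * Suc K" by simp
    finally show ?thesis .
  qed
  \<comment> \<open>\<open>y j\<close> is a subword of \<open>u' \<in> L\<close>. If it were longer
    than \<open>M'\<close>, the departure function at the successor of the radius would place its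
    value outside the ball of \<open>y_ball\<close>.\<close>
  have y_len: "length (y j) \<le> M'" if "j < n" for j
  proof (rule ccontr)
    assume "\<not> length (y j) \<le> M'"
    then have "D (Suc (M + 2 * Suc K)) \<le> length (y j)" using M' by simp
    moreover have "take (b j) u' @ y j @ drop (b (Suc j)) u' \<in> L"
      using y_split[OF that] u' by (metis append.assoc append_take_drop_id)
    ultimately have "Suc (M + 2 * Suc K) \<le> wlen G A \<alpha> (ev (y j))"
      using departure unfolding departure_function_def by blast
    moreover have "wlen G A \<alpha> (ev (y j)) \<le> M + 2 * Suc K"
      using y_ball[OF that] yA by (simp add: wlen_le_iff)
    ultimately show False by simp
  qed
  have y_concat: "concat (map y [0..<j]) = take (b j) u'" if "j \<le> n" for j
    using that
  proof (induction j)
    case 0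
    then show ?case by (simp add: b_def)
  next
    case (Suc j)
    then show ?case using y_split[of j] by simp
  qed
  have "concat (map y [0..<n]) = u'"
    using y_concat[of n] \<open>0 < n\<close> by (simp add: b_def)
  moreover have "length c \<le> M'" if "c \<in> set (map y [0..<n])" for c
    using that y_len by auto
  ultimately have y_greedy: "(local_move G F)\<^sup>*\<^sup>* (map ev (map y [0..<n])) (map ev (greedy_chunks M' n u'))"
    using rechunk_greedy[OF F(1), of "map y [0..<n]" n] A(2) by simp
  have x_greedy: "(local_move G F)\<^sup>*\<^sup>* (map ev xs) (map ev (greedy_chunks M' n u))"
    using rechunk_greedy[OF F(1), of xs n] A xs M'(1) by (metis le_trans)
  have "map (\<lambda>j. ev (xs ! j)) [0..<n] = map ev xs"
    using xs(2) by (intro nth_equalityI) simp_all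
  moreover have "(local_move G F)\<^sup>*\<^sup>* (map (\<lambda>j. ev (xs ! j)) [0..<n] @ [d n \<otimes> c]) (map (\<lambda>j. ev (y j)) [0..<n] @ [c])"
  proof (rule strip_moves)
    fix j assume j: "j < n"
    have "ev (xs ! j) \<in> gball M'" "ev (y j) \<in> gball M'"
      using gballI xsA[OF j] yA y_len[OF j] M'(1) by (auto intro: le_trans)
    moreover have "ev (xs ! j) \<otimes> d (Suc j) \<in> gball (M + 2 * Suc K)"
      using hd_ball[OF j] gball_mono[of "M + Suc K" "M + 2 * Suc K"] by auto
    ultimately show "{ev (xs ! j), ev (y j), ev (xs ! j) \<otimes> d (Suc j)} \<subseteq> F"
      using F by auto
  qed (use d0 dn strip c F gball_closed[OF d] in auto)
  ultimately have "(local_move G F)\<^sup>*\<^sup>* (map ev xs @ [e \<otimes> c]) (map ev (map y [0..<n]) @ [c])"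
    by (simp add: dn comp_def)
  \<comment> \<open>Three stages: recut \<open>u\<close> from chunk length \<open>M'\<close> to the
    chunks \<open>xs\<close>, pull \<open>e\<close> through them, and recut the pieces of
    \<open>u'\<close> greedily.\<close>
  then show ?thesis
    using local_moves_snoc[OF y_greedy, of "[c]"] local_moves_snoc[OF local_moves_sym[OF x_greedy], of "[e \<otimes> c]"]
    by (meson rtranclp_trans)
qed

text \<open>Fellow travelling concerns elements at distance at most 1, so the letters of
  \<open>a\<close> are absorbed one at a time, and the last entry holds the value of the letters to
  come.\<close>

lemma comb_word:
  assumes "0 < n"
    and M: "\<And>u. u \<in> L \<Longrightarrow> ev u \<in> gball (C * Suc n) \<Longrightarrow> length u \<le> M * n"
    and M': "M \<le> M'" "D (Suc (M + 2 * Suc K)) \<le> M'"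
    and F: "gball M' \<subseteq> F" "gball (M + 2 * Suc K) \<subseteq> F" "gball C \<subseteq> F" "F \<subseteq> carrier G"
  shows "a \<in> lists A \<Longrightarrow> length a \<le> C \<Longrightarrow> u \<in> L \<Longrightarrow> u' \<in> L \<Longrightarrow> ev u' = ev u \<otimes> ev a \<Longrightarrow>
    ev u \<in> gball m \<Longrightarrow> m + length a \<le> C * Suc n \<Longrightarrow>
    (local_move G F)\<^sup>*\<^sup>* (map ev (greedy_chunks M' n u) @ [ev a]) (map ev (greedy_chunks M' n u') @ [\<one>])"
proof (induction a arbitrary: u m)
  case Nil
  \<comment> \<open>\<open>u\<close> and \<open>u'\<close> may be different words of
    \<open>L\<close> for the same element, so a step with trivial difference is still
    required.\<close>
  have "length u \<le> M * n"
    using M Nil gball_mono[of m "C * Suc n"] by auto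
  moreover have "\<one> \<in> F" using F one_gball by auto
  ultimately show ?case
    using comb_step[of u u' n M \<one> M' F \<one>] Nil assms one_gball by auto
next
  case (Cons x a)
  have x: "x \<in> A" "\<alpha> x \<in> carrier G" "\<alpha> x \<in> gball 1" and a: "a \<in> lists A"
    using Cons.prems(1) value_closed gballI[of "[x]" 1] by auto
  have u: "ev u \<in> carrier G" using L_lists Cons.prems by simp
  have "ev u \<in> gball (C * Suc n)"
    using Cons.prems(6,7) gball_mono[of m "C * Suc n"] by auto
  then have len: "length u \<le> M * n" using M Cons.prems(3) by blast
  obtain v where v: "v \<in> L" "ev v = ev u \<otimes> \<alpha> x"
    using ex_L[of "ev u \<otimes> \<alpha> x"] x u by auto
  have "ev a \<in> gball C" "ev (x # a) \<in> gball C"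
    using Cons.prems by (auto intro!: gballI simp del: word_eval_Cons)
  then have "ev a \<in> F" "\<alpha> x \<otimes> ev a \<in> F" using F by auto
  then have "(local_move G F)\<^sup>*\<^sup>* (map ev (greedy_chunks M' n u) @ [\<alpha> x \<otimes> ev a]) (map ev (greedy_chunks M' n v) @ [ev a])"
    using comb_step[of u v n M "\<alpha> x" M' F "ev a"] Cons.prems(3) v assms(1) len x M' F by blast
  moreover have "(local_move G F)\<^sup>*\<^sup>* (map ev (greedy_chunks M' n v) @ [ev a]) (map ev (greedy_chunks M' n u') @ [\<one>])"
  proof (rule Cons.IH)
    show "ev u' = ev v \<otimes> ev a"
      using Cons.prems(5) v x u a by (simp add: m_assoc)
    \<comment> \<open>The radius grows by one while \<open>a\<close> loses a letter, so their sum
      keeps its bound and the next combing word again fits into \<open>n\<close> chunks.\<close>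
    show "ev v \<in> gball (m + 1)"
      using gball_mult[OF Cons.prems(6) x(3)] v by simp
  qed (use Cons.prems a v in auto)
  ultimately show ?case by simp
qed

lemma word_eval_gball:
  "set bs \<subseteq> gball C \<Longrightarrow> word_eval G (\<lambda>g. g) bs \<in> gball (C * length bs)"
proof (induction bs)
  case (Cons b bs)
  then show ?case using gball_mult[of b C "word_eval G (\<lambda>g. g) bs" "C * length bs"] by simp
qed (simp add: one_gball)

text \<open>Induction from the right: all entries but the last become chunks of a combing word, and
  the last entry is pulled through them, leaving an identity behind. At that moment a product of
  \<open>Suc n\<close> entries must fit into \<open>n\<close> chunks, hence the radius
  \<open>C * Suc n\<close> in the hypothesis on \<open>M\<close>.\<close>

lemma moves_to_chunks:
  assumes M: "\<And>u n. 0 < n \<Longrightarrow> u \<in> L \<Longrightarrow> ev u \<in> gball (C * Suc n) \<Longrightarrow> length u \<le> M * n"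
    and M': "M \<le> M'" "D (Suc (M + 2 * Suc K)) \<le> M'"
    and F: "gball M' \<subseteq> F" "gball (M + 2 * Suc K) \<subseteq> F" "gball C \<subseteq> F" "F \<subseteq> carrier G"
    and "bs \<noteq> []" "set bs \<subseteq> gball C" "u \<in> L" "ev u = word_eval G (\<lambda>g. g) bs"
  shows "(local_move G F)\<^sup>*\<^sup>* bs (map ev (greedy_chunks M' (length bs) u))"
  using assms(8-)
proof (induction bs arbitrary: u rule: rev_nonempty_induct)
  case (single b)
  then have b: "b \<in> gball C" "ev u = b" using gball_closed by auto
  \<comment> \<open>The combing word of a single entry fits into one chunk, whose value is that
    entry, so no move is made.\<close>
  then have "length u \<le> M * 1"
    using M[of 1 u] single.prems(2) gball_mono[of C "C * Suc 1"] by auto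
  then show ?case using M' b by simp
next
  case (snoc b bs)
  let ?n = "length bs" and ?g = "word_eval G (\<lambda>g. g) bs"
  have n: "0 < ?n" using snoc.hyps by simp
  have bs: "set bs \<subseteq> gball C" and b: "b \<in> gball C" using snoc.prems by auto
  have g: "?g \<in> gball (C * ?n)" using word_eval_gball[OF bs] .
  obtain a where a: "a \<in> lists A" "length a \<le> C" "b = ev a"
    using b unfolding gball_def by blast
  obtain v where v: "v \<in> L" "ev v = ?g" using ex_L[of ?g] gball_closed[OF g] by blast
  have "word_eval G (\<lambda>g. g) (bs @ [b]) = ?g \<otimes> word_eval G (\<lambda>g. g) [b]"
    using bs b by (intro word_eval_append) (auto intro: gball_closed)
  then have u: "ev u = ev v \<otimes> ev a"
    using snoc.prems(3) v a by simp
  have "word_eval G (\<lambda>g. g) (bs @ [b]) \<in> gball (C * Suc ?n)"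
    using word_eval_gball[OF snoc.prems(1)] by simp
  then have "length u \<le> M * ?n"
    using M[OF n snoc.prems(2)] snoc.prems(3) by simp
  also have "\<dots> \<le> M' * ?n" using M' by simp
  finally have len: "length u \<le> M' * ?n" .
  have "(local_move G F)\<^sup>*\<^sup>* (bs @ [b]) (map ev (greedy_chunks M' ?n v) @ [ev a])"
    unfolding a(3)[symmetric] by (rule local_moves_snoc[OF snoc.IH[OF bs v]])
  also have "(local_move G F)\<^sup>*\<^sup>* \<dots> (map ev (greedy_chunks M' ?n u) @ [\<one>])"
  proof (rule comb_word[OF n M[OF n] M' F a(1,2) v(1) snoc.prems(2) u])
    show "ev v \<in> gball (C * ?n)" using g v by simp
  qed (use a in simp_all)
  \<comment> \<open>The identity left behind is read as an empty chunk, so only a recutting of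
    \<open>u\<close> remains.\<close>
  also have "map ev (greedy_chunks M' ?n u) @ [\<one>] = map ev (greedy_chunks M' ?n u @ [[]])"
    by simp
  also have "(local_move G F)\<^sup>*\<^sup>* \<dots> (map ev (greedy_chunks M' (length (bs @ [b])) u))"
  proof -
    have conc: "concat (greedy_chunks M' ?n u @ [[]]) = u"
      using concat_greedy_chunks[OF len] by simp
    have "(local_move G F)\<^sup>*\<^sup>* (map ev (greedy_chunks M' ?n u @ [[]]))
      (map ev (greedy_chunks M' (Suc ?n) (concat (greedy_chunks M' ?n u @ [[]]))))"
    proof (rule rechunk_greedy[OF F(1)])
      show "concat (greedy_chunks M' ?n u @ [[]]) \<in> lists A"
        unfolding conc by (rule L_lists[OF snoc.prems(2)])
    qed (use greedy_chunks_bound in fastforce)+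
    then show ?thesis unfolding conc by simp
  qed
  finally show ?case .
qed

section \<open>Shortness and the choice of constants\<close>

lemma short_bound:
  assumes "short_lang G A \<alpha> L"
  shows "\<exists>M. \<forall>u n. 0 < n \<longrightarrow> u \<in> L \<longrightarrow> ev u \<in> gball (C * Suc n) \<longrightarrow> length u \<le> M * n"
proof -
  obtain c e :: real where ce: "\<And>w. w \<in> L \<Longrightarrow> real (length w) \<le> c * real (wlen G A \<alpha> (ev w)) + e"
    using assms unfolding short_lang_def by blast
  \<comment> \<open>The factor 2 comes from \<open>Suc n \<le> 2 * n\<close> for positive
    \<open>n\<close>, which also lets \<open>M * n\<close> absorb the additive constant. Absolute
    values allow for any signs of \<open>c\<close> and \<open>e\<close>.\<close>
  define M where "M = nat \<lceil>\<bar>c\<bar> * (2 * real C) + \<bar>e\<bar>\<rceil>"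
  have "length u \<le> M * n" if n: "0 < n" and u: "u \<in> L" "ev u \<in> gball (C * Suc n)" for u n
  proof -
    have "wlen G A \<alpha> (ev u) \<le> C * Suc n"
      using u L_lists by (simp add: wlen_le_iff)
    also have "\<dots> \<le> 2 * C * n" using n by (cases n) auto
    finally have w: "real (wlen G A \<alpha> (ev u)) \<le> 2 * real C * real n"
      by (metis of_nat_le_iff of_nat_mult of_nat_numeral)
    have "real (length u) \<le> c * real (wlen G A \<alpha> (ev u)) + e" using ce u by blast
    also have "\<dots> \<le> \<bar>c\<bar> * real (wlen G A \<alpha> (ev u)) + \<bar>e\<bar>"
      by (intro add_mono mult_right_mono) auto
    also have "\<dots> \<le> \<bar>c\<bar> * (2 * real C * real n) + \<bar>e\<bar> * real n"
    proof (intro add_mono mult_left_mono w)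
      show "\<bar>e\<bar> \<le> \<bar>e\<bar> * real n" using n mult_left_mono[of 1 "real n" "\<bar>e\<bar>"] by simp
    qed simp
    also have "\<dots> = (\<bar>c\<bar> * (2 * real C) + \<bar>e\<bar>) * real n" by (simp add: algebra_simps)
    also have "\<dots> \<le> real M * real n"
      unfolding M_def by (intro mult_right_mono) linarith+
    finally have "real (length u) \<le> real (M * n)" by simp
    then show ?thesis by (simp only: of_nat_le_iff)
  qed
  then show ?thesis by blast
qed

text \<open>Both lists move to the same chunks of one combing word for the identity, and moves are
  reversible. The alphabet \<open>F\<close> is chosen before the length of the list.\<close>

theorem moves_between_trivial_products:
  assumes "short_lang G A \<alpha> L"
  shows "\<exists>F. finite F \<and> gball C \<subseteq> F \<and> F \<subseteq> carrier G \<and>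
    (\<forall>bs. bs \<noteq> [] \<longrightarrow> set bs \<subseteq> gball C \<longrightarrow> word_eval G (\<lambda>g. g) bs = \<one> \<longrightarrow>
      (local_move G F)\<^sup>*\<^sup>* (replicate (length bs) \<one>) bs)"
proof -
  obtain M where M: "\<And>u n. 0 < n \<Longrightarrow> u \<in> L \<Longrightarrow> ev u \<in> gball (C * Suc n) \<Longrightarrow> length u \<le> M * n"
    using short_bound[OF assms] by blast
  \<comment> \<open>\<open>M'\<close> bounds the old chunks and, by the departure function, the new
    pieces. Adding three radii gives one ball \<open>F\<close> for the chunks, the carried products
    and the letters.\<close>
  define M' where "M' = max M (D (Suc (M + 2 * Suc K)))"
  define F where "F = gball (M' + (M + 2 * Suc K) + C)"
  have M': "M \<le> M'" "D (Suc (M + 2 * Suc K)) \<le> M'" unfolding M'_def by auto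
  have F: "gball M' \<subseteq> F" "gball (M + 2 * Suc K) \<subseteq> F" "gball C \<subseteq> F" "F \<subseteq> carrier G"
    unfolding F_def by (auto intro!: gball_mono simp del: mult_Suc_right dest: gball_closed)
  obtain u where u: "u \<in> L" "ev u = \<one>" using ex_L by blast
  have "(local_move G F)\<^sup>*\<^sup>* (replicate (length bs) \<one>) bs"
    if bs: "bs \<noteq> []" "set bs \<subseteq> gball C" "word_eval G (\<lambda>g. g) bs = \<one>" for bs
  proof -
    note moves = moves_to_chunks[OF M M' F]
    have "(local_move G F)\<^sup>*\<^sup>* bs (map ev (greedy_chunks M' (length bs) u))"
      using bs u by (intro moves) simp_all
    moreover have "(local_move G F)\<^sup>*\<^sup>* (replicate (length bs) \<one>)
        (map ev (greedy_chunks M' (length (replicate (length bs) \<one>)) u))"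
      using bs u one_gball by (intro moves) (auto simp: word_eval_replicate_one)
    ultimately show ?thesis
      by (metis length_replicate local_moves_sym rtranclp_trans)
  qed
  moreover have "finite F" unfolding F_def by (rule finite_gball)
  ultimately show ?thesis using F by blast
qed

end

section \<open>From local moves to a grammar for the word problem\<close>

lemma (in group) context_sensitive_word_problem:
  assumes "finite B" "finite F" "F \<subseteq> carrier G" "\<one> \<in> F" "\<beta> ` B \<subseteq> F"
    and reach: "\<And>bs. bs \<noteq> [] \<Longrightarrow> set bs \<subseteq> \<beta> ` B \<Longrightarrow> word_eval G (\<lambda>g. g) bs = \<one> \<Longrightarrow>
      (local_move G F)\<^sup>*\<^sup>* (replicate (length bs) \<one>) bs"
  shows "context_sensitive (word_problem G B \<beta> - {[]})"
proof -
  \<comment> \<open>Cells of the grammar are numbers, so the finite alphabet is coded by an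
    injection with partial inverse \<open>val\<close>.\<close>
  obtain f :: "'a \<Rightarrow> nat" where f: "inj_on f F"
    using finite_imp_inj_to_nat_seg[OF \<open>finite F\<close>] by blast
  define val where "val = inv_into F f"
  have val: "val (f g) = g" if "g \<in> F" for g
    unfolding val_def using f that by simp
  define R where "R = (\<lambda>(g, h, g', h'). (f g, f h, f g', f h')) `
    {(g, h, g', h'). g \<in> F \<and> h \<in> F \<and> g' \<in> F \<and> h' \<in> F \<and> g \<otimes> h = g' \<otimes> h'}"
  \<comment> \<open>The invariant set consists of the coded lists of product 1; inserting a coded
    identity or making a coded local move preserves the product.\<close>
  define V where "V = {x. set x \<subseteq> f ` F \<and> word_eval G val x = \<one>}"
  have val_closed: "val i \<in> carrier G" if "i \<in> f ` F" for i
    using that val assms(3) by auto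
  have append: "word_eval G val (x @ y) = word_eval G val x \<otimes> word_eval G val y"
    if "set x \<subseteq> f ` F" "set y \<subseteq> f ` F" for x y
    using that val_closed by (intro word_eval_append) blast
  have closed: "word_eval G val x \<in> carrier G" if "set x \<subseteq> f ` F" for x
    using that val_closed by (intro word_eval_closed) blast
  have "context_sensitive ({w \<in> lists B. map (\<lambda>b. f (\<beta> b)) w \<in> V} - {[]})"
  proof (rule context_sensitive_pair_rewriting[where z = "f \<one>" and R = R])
    have "finite (F \<times> F \<times> F \<times> F)" using assms(2) by simp
    then have "finite {(g, h, g', h'). g \<in> F \<and> h \<in> F \<and> g' \<in> F \<and> h' \<in> F \<and> g \<otimes> h = g' \<otimes> h'}"
      by (rule rev_finite_subset) auto
    then show "finite R" unfolding R_def by (rule finite_imageI)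
    show "finite B" "[] \<in> V" using assms(1) by (simp_all add: V_def)
    show "x @ f \<one> # y \<in> V" if "x @ y \<in> V" for x y
    proof -
      have "set x \<subseteq> f ` F" "set y \<subseteq> f ` F" "set (f \<one> # y) \<subseteq> f ` F"
        using that assms(4) by (auto simp: V_def)
      then show ?thesis
        using that append[of x y] append[of x "f \<one> # y"] val[OF assms(4)] closed[of y] by (simp add: V_def)
    qed
    show "y \<in> V" if x: "x \<in> V" and xy: "pair_step R x y" for x y
    proof -
      obtain u v g h g' h' where *: "g \<in> F" "h \<in> F" "g' \<in> F" "h' \<in> F" "g \<otimes> h = g' \<otimes> h'"
        "x = u @ [f g, f h] @ v" "y = u @ [f g', f h'] @ v"
        using xy unfolding pair_step_def R_def by auto
      have sets: "set u \<subseteq> f ` F" "set v \<subseteq> f ` F" "set ([f g, f h] @ v) \<subseteq> f ` F" "set ([f g', f h'] @ v) \<subseteq> f ` F"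
        using x * by (auto simp: V_def)
      have carr: "g \<in> carrier G" "h \<in> carrier G" "g' \<in> carrier G" "h' \<in> carrier G"
        using * assms(3) by auto
      have "word_eval G val ([f g, f h] @ v) = word_eval G val ([f g', f h'] @ v)"
        using * carr closed[OF sets(2)] by (simp add: val m_assoc[symmetric])
      then have "word_eval G val x = word_eval G val y"
        unfolding *(6,7) using append sets by metis
      then show ?thesis using x sets * by (auto simp: V_def)
    qed
    fix w assume w: "w \<in> lists B" "w \<noteq> []" "map (\<lambda>b. f (\<beta> b)) w \<in> V"
    have simulate: "(pair_step R)\<^sup>*\<^sup>* (map f x) (map f y)" if "(local_move G F)\<^sup>*\<^sup>* x y" for x y
      using that
    proof (induction rule: rtranclp_induct)
      case (step y z)
      then obtain u v g h g' h' where *: "{g, h, g', h'} \<subseteq> F" "g \<otimes> h = g' \<otimes> h'"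
        "y = u @ [g, h] @ v" "z = u @ [g', h'] @ v"
        unfolding local_move_def by blast
      have "(f g, f h, f g', f h') \<in> R"
        unfolding R_def using * by (intro rev_image_eqI[of "(g, h, g', h')"]) auto
      then have "pair_step R (map f y) (map f z)"
        unfolding pair_step_def *(3,4) map_append list.map by blast
      with step.IH show ?case by simp
    qed simp
    have "word_eval G (\<lambda>g. g) (map \<beta> w) = word_eval G val (map (\<lambda>b. f (\<beta> b)) w)"
    proof -
      have "map val (map (\<lambda>b. f (\<beta> b)) w) = map \<beta> w"
        using w(1) val assms(5) by (auto simp: lists_eq_set)
      then show ?thesis
        using word_eval_map[of G "\<lambda>g. g" val "map (\<lambda>b. f (\<beta> b)) w"] by (simp only:)
    qed
    then have "(local_move G F)\<^sup>*\<^sup>* (replicate (length (map \<beta> w)) \<one>) (map \<beta> w)"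
      using w by (intro reach) (auto simp: V_def)
    from simulate[OF this] show "(pair_step R)\<^sup>*\<^sup>* (replicate (length w) (f \<one>)) (map (\<lambda>b. f (\<beta> b)) w)"
      by (simp add: map_replicate comp_def)
  qed
  moreover have "word_problem G B \<beta> = {w \<in> lists B. map (\<lambda>b. f (\<beta> b)) w \<in> V}"
  proof -
    have "word_eval G \<beta> w = word_eval G val (map (\<lambda>b. f (\<beta> b)) w) \<and> set (map (\<lambda>b. f (\<beta> b)) w) \<subseteq> f ` F"
      if "w \<in> lists B" for w
      using that
    proof (induction w)
      case (Cons b w)
      then have "\<beta> b \<in> F" using assms(5) by auto
      then show ?case using Cons val by simp
    qed simp
    then show ?thesis unfolding word_problem_def V_def
      by (intro Collect_cong conj_cong) simp_all
  qed
  ultimately show ?thesis by simp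
qed

section \<open>Word problems of finitely generated subgroups\<close>

theorem mainTheorem1:
  fixes G :: "('g, 'm) monoid_scheme"
    and A :: "'a set" and \<alpha> :: "'a \<Rightarrow> 'g" and \<iota> :: "'a \<Rightarrow> 'a"
    and L :: "'a list set"
    and H :: "'g set"
  assumes "group G"
    and "monoid_gen_set G (carrier G) A \<alpha>"
    and "inverse_involution G A \<alpha> \<iota>"
    and "normal_form G A \<alpha> L"
    and "short_lang G A \<alpha> L"
    and "async_combing G A \<alpha> L"
    and "\<exists>D. departure_function G A \<alpha> L D"
    and "context_sensitive (L - {[]})"
    and "subgroup H G"
    and "\<exists>S. finite S \<and> S \<subseteq> carrier G \<and> generate G S = H"
  shows "\<forall>(B :: 'b set) (\<beta> :: 'b \<Rightarrow> 'g). monoid_gen_set G H B \<beta> \<longrightarrow>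
           context_sensitive (word_problem G B \<beta> - {[]})"
proof (intro allI impI)
  fix B :: "'b set" and \<beta> :: "'b \<Rightarrow> 'g"
  assume B: "monoid_gen_set G H B \<beta>"
  interpret group G by fact
  interpret generated_group G A \<alpha> \<iota>
    using assms by unfold_locales
  obtain D where D: "departure_function G A \<alpha> L D" using assms by blast
  obtain k :: real where k: "\<And>w w'. w \<in> L \<Longrightarrow> w' \<in> L \<Longrightarrow> cdist G A \<alpha> (ev w) (ev w') \<le> 1 \<Longrightarrow>
      \<exists>r r'. reparam r \<and> reparam r' \<and>
        (\<forall>t\<ge>0. cpdist G A \<alpha> (word_path G \<alpha> w (r t)) (word_path G \<alpha> w' (r' t)) \<le> k)"
    using assms(6) unfolding async_combing_def by blast
  \<comment> \<open>The real fellow traveller constant is rounded up to a natural number.\<close>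
  interpret combed_group G A \<alpha> \<iota> L "nat \<lceil>k\<rceil>" D
  proof
    show "\<exists>r r'. reparam r \<and> reparam r' \<and>
        (\<forall>t\<ge>0. cpdist G A \<alpha> (word_path G \<alpha> w (r t)) (word_path G \<alpha> w' (r' t)) \<le> real (nat \<lceil>k\<rceil>))"
      if "w \<in> L" "w' \<in> L" "cdist G A \<alpha> (ev w) (ev w') \<le> 1" for w w'
      using k[OF that] real_nat_ceiling_ge[of k] by (meson order_trans)
  qed (use assms D in auto)
  have "finite B" and \<beta>: "\<beta> ` B \<subseteq> H"
    using B unfolding monoid_gen_set_def by auto
  have "\<exists>C. \<beta> ` B \<subseteq> gball C"
  proof -
    have carr: "\<beta> b \<in> carrier G" if "b \<in> B" for b
      using that \<beta> subgroup.subset[OF assms(9)] by blast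
    \<comment> \<open>The inserted 0 makes the maximum meaningful for empty
      \<open>B\<close>.\<close>
    define C where "C = Max (insert 0 ((\<lambda>b. wlen G A \<alpha> (\<beta> b)) ` B))"
    have "\<beta> b \<in> gball C" if "b \<in> B" for b
    proof -
      have "wlen G A \<alpha> (\<beta> b) \<le> C"
        unfolding C_def using \<open>finite B\<close> that by (intro Max_ge) auto
      then show ?thesis using wlen_le_iff[OF carr[OF that]] by blast
    qed
    then show ?thesis by blast
  qed
  then obtain C where C: "\<beta> ` B \<subseteq> gball C" ..
  \<comment> \<open>The moves take place in \<open>G\<close>: intermediate lists may have entries
    outside \<open>H\<close>, and the word problem for \<open>B\<close> asks only whether the
    product in \<open>G\<close> is trivial.\<close>
  obtain F where F: "finite F" "gball C \<subseteq> F" "F \<subseteq> carrier G"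
    and reach: "\<And>bs. bs \<noteq> [] \<Longrightarrow> set bs \<subseteq> gball C \<Longrightarrow> word_eval G (\<lambda>g. g) bs = \<one>\<^bsub>G\<^esub> \<Longrightarrow>
      (local_move G F)\<^sup>*\<^sup>* (replicate (length bs) \<one>\<^bsub>G\<^esub>) bs"
    using moves_between_trivial_products[OF assms(5), of C] by blast
  show "context_sensitive (word_problem G B \<beta> - {[]})"
  proof (rule context_sensitive_word_problem[OF \<open>finite B\<close> F(1,3)])
    show "\<one>\<^bsub>G\<^esub> \<in> F" using F(2) one_gball by blast
    show "\<beta> ` B \<subseteq> F" using C F(2) by (rule subset_trans)
    show "(local_move G F)\<^sup>*\<^sup>* (replicate (length bs) \<one>\<^bsub>G\<^esub>) bs"
      if "bs \<noteq> []" "set bs \<subseteq> \<beta> ` B" "word_eval G (\<lambda>g. g) bs = \<one>\<^bsub>G\<^esub>" for bs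
      using reach[OF that(1) subset_trans[OF that(2) C] that(3)] .
  qed
qed

end
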